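(* Let $\langle\chi,\vec a\rangle$ be a loop and $\check\phi$ a quantifier-free formula over $\vec x$, where $\chi(\vec x)\equiv\bigwedge_{i=1}^k C_i$ in CNF and each clause $C_i$ contains an inequation $e_i(\vec x)>0$ (as one of its disjuncts) such that \[ \check\phi(\vec x)\land e_i(\vec x)\le e_i(\vec a(\vec x))\implies e_i(\vec a(\vec x))\le e_i(\vec a^2(\vec x)) \] is valid for each $i$. Then mapping $(\langle\chi,\vec a\rangle,\check\phi)$ to \[ \bigwedge_{i=1}^k 0<e_i(\vec x)\le e_i(\vec a(\vec x)) \] is a conditional non-termination technique; i.e., every $\vec x\in\mathbb Z^d$ that is a witness of non-termination for $\langle\check\phi,\vec a\rangle$ and satisfies $\bigwedge_{i=1}^k 0<e_i(\vec x)\le e_i(\vec a(\vec x))$ is a witness of non-termination for $\langle\chi,\vec a\rangle$.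
   Context: Fix $d\ge 1$ and integer variables $\vec x=(x_1,\dots,x_d)$. A loop $\langle\chi,\vec a\rangle$ consists of a quantifier-free formula $\chi$ over atoms $p>0$ ($p$ an arithmetic expression over $\vec x$, integer semantics) and a map $\vec a:\mathbb Z^d\to\mathbb Z^d$ given by expressions over $\vec x$; $\vec a^m$ is $m$-fold application ($\vec a^0=\mathrm{id}$). A vector $\vec x\in\mathbb Z^d$ is a witness of non-termination for $\langle\chi,\vec a\rangle$ if $\chi(\vec a^m(\vec x))$ holds for all $m\in\mathbb N$. A conditional non-termination technique is a partial function $\mathit{nt}$ mapping pairs (loop $\langle\chi,\vec a\rangle$, quantifier-free formula $\check\phi$ over $\vec x$) to quantifier-free formulas over $\vec x$ such that for all pairs in its domain and all $\vec x$: if $\vec x$ is a witness of non-termination for $\langle\check\phi,\vec a\rangle$ and $\mathit{nt}(\langle\chi,\vec a\rangle,\check\phi)(\vec x)$ holds, then $\vec x$ is a witness of non-termination for $\langle\chi,\vec a\rangle$. Validity means truth for all integer values of the free variables. *)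

theory Defs
  imports "HOL-Analysis.Finite_Cartesian_Product"
begin

text \<open>
  The \<open>d \<ge> 1\<close> program variables are indexed by a finite (hence nonempty) type \<open>'d\<close>, and states
  have type \<open>int ^ 'd\<close>. Expressions have integer values. Which operations besides addition,
  subtraction and multiplication are available (division, exponentiation, ...) is left open:
  they are symbols of type \<open>'f\<close>, with a semantics given by an interpretation
  \<open>I :: 'f \<Rightarrow> int list \<Rightarrow> int\<close>.
\<close>

datatype ('f, 'd) aexp =
    Var 'd
  | Const int
  | Add "('f, 'd) aexp" "('f, 'd) aexp"
  | Sub "('f, 'd) aexp" "('f, 'd) aexp"
  | Mul "('f, 'd) aexp" "('f, 'd) aexp"
  | Op 'f "('f, 'd) aexp list"

primrec aval :: "('f \<Rightarrow> int list \<Rightarrow> int) \<Rightarrow> ('f, 'd::finite) aexp \<Rightarrow> int ^ 'd \<Rightarrow> int" where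
  "aval I (Var i) x = x $ i"
| "aval I (Const c) x = c"
| "aval I (Add p q) x = aval I p x + aval I q x"
| "aval I (Sub p q) x = aval I p x - aval I q x"
| "aval I (Mul p q) x = aval I p x * aval I q x"
| "aval I (Op f ps) x = I f (map (\<lambda>p. aval I p x) ps)"

primrec asubst :: "('f, 'd::finite) aexp ^ 'd \<Rightarrow> ('f, 'd) aexp \<Rightarrow> ('f, 'd) aexp" where
  "asubst a (Var i) = a $ i"
| "asubst a (Const c) = Const c"
| "asubst a (Add p q) = Add (asubst a p) (asubst a q)"
| "asubst a (Sub p q) = Sub (asubst a p) (asubst a q)"
| "asubst a (Mul p q) = Mul (asubst a p) (asubst a q)"
| "asubst a (Op f ps) = Op f (map (asubst a) ps)"

text \<open>Quantifier-free formulas; \<open>Pos p\<close> is the atom \<open>p > 0\<close>.\<close>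

datatype ('f, 'd) form =
    Top
  | Bot
  | Pos "('f, 'd) aexp"
  | Neg "('f, 'd) form"
  | And "('f, 'd) form" "('f, 'd) form"
  | Or "('f, 'd) form" "('f, 'd) form"

primrec holds :: "('f \<Rightarrow> int list \<Rightarrow> int) \<Rightarrow> ('f, 'd::finite) form \<Rightarrow> int ^ 'd \<Rightarrow> bool" where
  "holds I Top x \<longleftrightarrow> True"
| "holds I Bot x \<longleftrightarrow> False"
| "holds I (Pos p) x \<longleftrightarrow> aval I p x > 0"
| "holds I (Neg \<phi>) x \<longleftrightarrow> \<not> holds I \<phi> x"
| "holds I (And \<phi> \<psi>) x \<longleftrightarrow> holds I \<phi> x \<and> holds I \<psi> x"
| "holds I (Or \<phi> \<psi>) x \<longleftrightarrow> holds I \<phi> x \<or> holds I \<psi> x"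

text \<open>Over the integers, \<open>p \<le> q\<close> is the atom \<open>q - p + 1 > 0\<close>.\<close>

definition Le :: "('f, 'd) aexp \<Rightarrow> ('f, 'd) aexp \<Rightarrow> ('f, 'd) form" where
  "Le p q = Pos (Add (Sub q p) (Const 1))"

definition Conj :: "('f, 'd) form list \<Rightarrow> ('f, 'd) form" where
  "Conj \<phi>s = foldr And \<phi>s Top"

definition Disj :: "('f, 'd) form list \<Rightarrow> ('f, 'd) form" where
  "Disj \<phi>s = foldr Or \<phi>s Bot"

definition is_literal :: "('f, 'd) form \<Rightarrow> bool" where
  "is_literal \<phi> \<longleftrightarrow> (\<exists>p. \<phi> = Pos p \<or> \<phi> = Neg (Pos p))"

text \<open>\<open>Cs\<close> lists the clauses of a CNF of \<open>cond\<close>, each clause being the list of its literals.\<close>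

definition is_cnf_of ::
    "('f \<Rightarrow> int list \<Rightarrow> int) \<Rightarrow> ('f, 'd::finite) form list list \<Rightarrow> ('f, 'd) form \<Rightarrow> bool" where
  "is_cnf_of I Cs cond \<longleftrightarrow>
     (\<forall>C \<in> set Cs. \<forall>l \<in> set C. is_literal l) \<and>
     (\<forall>x. holds I cond x \<longleftrightarrow> holds I (Conj (map Disj Cs)) x)"

text \<open>A loop is a pair of its condition and its update.\<close>

type_synonym ('f, 'd) loop = "('f, 'd) form \<times> (('f, 'd) aexp, 'd) vec"

definition step :: "('f \<Rightarrow> int list \<Rightarrow> int) \<Rightarrow> ('f, 'd::finite) aexp ^ 'd \<Rightarrow> int ^ 'd \<Rightarrow> int ^ 'd" where
  "step I a x = (\<chi> i. aval I (a $ i) x)"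

definition nonterm_witness ::
    "('f \<Rightarrow> int list \<Rightarrow> int) \<Rightarrow> ('f, 'd::finite) loop \<Rightarrow> int ^ 'd \<Rightarrow> bool" where
  "nonterm_witness I L x \<longleftrightarrow> (\<forall>m. holds I (fst L) ((step I (snd L) ^^ m) x))"

definition conditional_nonterm_technique ::
    "('f \<Rightarrow> int list \<Rightarrow> int) \<Rightarrow> (('f, 'd::finite) loop \<times> ('f, 'd) form \<rightharpoonup> ('f, 'd) form) \<Rightarrow> bool" where
  "conditional_nonterm_technique I nt \<longleftrightarrow>
     (\<forall>cond a \<phi> \<psi> x. nt ((cond, a), \<phi>) = Some \<psi> \<longrightarrow>
        nonterm_witness I (\<phi>, a) x \<longrightarrow> holds I \<psi> x \<longrightarrow> nonterm_witness I (cond, a) x)"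

text \<open>
  The premises of conditional non-termination via eventual increase: \<open>es ! i\<close> is the expression
  of the inequation chosen from the \<open>i\<close>-th clause.
\<close>

definition eventual_increase ::
    "('f \<Rightarrow> int list \<Rightarrow> int) \<Rightarrow> ('f, 'd::finite) loop \<Rightarrow> ('f, 'd) form \<Rightarrow>
     ('f, 'd) form list list \<Rightarrow> ('f, 'd) aexp list \<Rightarrow> bool" where
  "eventual_increase I L \<phi> Cs es \<longleftrightarrow>
     is_cnf_of I Cs (fst L) \<and>
     length es = length Cs \<and>
     (\<forall>i < length Cs. Pos (es ! i) \<in> set (Cs ! i)) \<and>
     (\<forall>i < length Cs. \<forall>x.
        holds I \<phi> x \<and> aval I (es ! i) x \<le> aval I (es ! i) (step I (snd L) x) \<longrightarrow>
        aval I (es ! i) (step I (snd L) x) \<le> aval I (es ! i) ((step I (snd L) ^^ 2) x))"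

definition eventual_increase_form ::
    "('f, 'd::finite) aexp ^ 'd \<Rightarrow> ('f, 'd) aexp list \<Rightarrow> ('f, 'd) form" where
  "eventual_increase_form a es = Conj (map (\<lambda>e. And (Pos e) (Le e (asubst a e))) es)"

lemma aval_asubst: "aval I (asubst a e) x = aval I e (step I a x)"
  by (induction e) (auto simp: step_def comp_def intro!: arg_cong[where f = "I _"])

lemma holds_Le [simp]: "holds I (Le p q) x \<longleftrightarrow> aval I p x \<le> aval I q x"
  by (auto simp: Le_def)

lemma holds_Conj [simp]: "holds I (Conj \<phi>s) x \<longleftrightarrow> (\<forall>\<phi> \<in> set \<phi>s. holds I \<phi> x)"
  by (induction \<phi>s) (auto simp: Conj_def)

lemma holds_Disj [simp]: "holds I (Disj \<phi>s) x \<longleftrightarrow> (\<exists>\<phi> \<in> set \<phi>s. holds I \<phi> x)"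
  by (induction \<phi>s) (auto simp: Disj_def)

lemma holds_eventual_increase_form:
  "holds I (eventual_increase_form a es) x \<longleftrightarrow>
     (\<forall>e \<in> set es. 0 < aval I e x \<and> aval I e x \<le> aval I e (step I a x))"
  by (auto simp: eventual_increase_form_def aval_asubst)

end

theory Submission
  imports Defs
begin

text \<open>Along the orbit of \<open>x\<close>, the guard \<open>\<phi>\<close> holds at every
  point, so the premise says that one non-decreasing step of a chosen \<open>e\<close> forces the
  next one. As the first step is non-decreasing, induction makes \<open>e\<close> weakly increasing
  along the whole orbit (\<open>increase_along_iterates\<close>). It starts positive, so it stays
  positive and its clause holds forever. Doing this for each clause separately gives the CNF of the
  loop condition at every iterate (\<open>eventual_increase_nonterm_witness\<close>).\<close>

lemma increase_along_iterates:
  fixes f :: "'a \<Rightarrow> int"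
  assumes "\<And>m. P ((g ^^ m) x)"
    and "\<And>y. P y \<Longrightarrow> f y \<le> f (g y) \<Longrightarrow> f (g y) \<le> f (g (g y))"
    and "0 < f x" "f x \<le> f (g x)"
  shows "0 < f ((g ^^ m) x) \<and> f ((g ^^ m) x) \<le> f (g ((g ^^ m) x))"
proof (induction m)
  case 0
  show ?case using assms(3,4) by simp
next
  \<comment> \<open>Positivity alone is not inductive: it passes to the next iterate through the
    inequality, which \<open>assms(2)\<close> renews because \<open>P\<close> holds at the current
    iterate.\<close>
  case (Suc m)
  then show ?case using assms(1)[of m] assms(2)[of "(g ^^ m) x"] by simp
qed

text \<open>One true disjunct suffices for a clause, and the same disjunct
  \<open>Pos (es ! i)\<close> serves at all iterates.\<close>

lemma eventual_increase_nonterm_witness: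
  assumes ei: "eventual_increase I (cond, a) \<phi> Cs es"
    and wit: "nonterm_witness I (\<phi>, a) x"
    and incr: "\<And>i. i < length Cs \<Longrightarrow>
      0 < aval I (es ! i) x \<and> aval I (es ! i) x \<le> aval I (es ! i) (step I a x)"
  shows "nonterm_witness I (cond, a) x"
proof -
  have cnf: "holds I cond y \<longleftrightarrow> (\<forall>C \<in> set Cs. holds I (Disj C) y)" for y
    using ei by (simp add: eventual_increase_def is_cnf_of_def)
  have "holds I (Disj C) ((step I a ^^ m) x)" if C: "C \<in> set Cs" for C m
  proof -
    from C obtain i where i: "i < length Cs" and C_eq: "C = Cs ! i"
      by (metis in_set_conv_nth)
    let ?f = "aval I (es ! i)"
    have Pos: "Pos (es ! i) \<in> set C"
      using ei i C_eq by (simp add: eventual_increase_def)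
    have "0 < ?f ((step I a ^^ m) x)"
    proof (rule increase_along_iterates[THEN conjunct1])
      show "holds I \<phi> ((step I a ^^ n) x)" for n
        using wit by (simp add: nonterm_witness_def)
      show "?f (step I a (step I a y)) \<ge> ?f (step I a y)"
        if "holds I \<phi> y" "?f y \<le> ?f (step I a y)" for y
        \<comment> \<open>\<open>numeral_2_eq_2\<close> unfolds the power \<open>^^ 2\<close> in the
          premise into two applications of \<open>step\<close>.\<close>
        using ei i that by (simp add: eventual_increase_def numeral_2_eq_2)
    qed (use incr[OF i] in auto)
    with Pos show ?thesis
      by (metis holds.simps(3) holds_Disj)
  qed
  then show ?thesis
    by (simp add: nonterm_witness_def cnf del: holds_Disj)
qed

text \<open>A loop and \<open>\<phi>\<close> determine neither the CNF nor the inequations chosen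
  from it, so the first conjunct covers every partial function whose values arise from some such
  choice. The second is the pointwise form.\<close>

theorem theorem17:
  fixes I :: "'f \<Rightarrow> int list \<Rightarrow> int"
  shows
    "(\<forall>nt :: ('f, 'd::finite) loop \<times> ('f, 'd) form \<rightharpoonup> ('f, 'd) form.
        (\<forall>cond a \<phi> \<psi>. nt ((cond, a), \<phi>) = Some \<psi> \<longrightarrow>
           (\<exists>Cs es. eventual_increase I (cond, a) \<phi> Cs es \<and> \<psi> = eventual_increase_form a es)) \<longrightarrow>
        conditional_nonterm_technique I nt) \<and>
     (\<forall>(cond :: ('f, 'd) form) a \<phi> Cs es x.
        eventual_increase I (cond, a) \<phi> Cs es \<longrightarrow>
        nonterm_witness I (\<phi>, a) x \<longrightarrow>
        (\<forall>i < length Cs. 0 < aval I (es ! i) x \<and> aval I (es ! i) x \<le> aval I (es ! i) (step I a x)) \<longrightarrow>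
        nonterm_witness I (cond, a) x)"
proof (intro conjI allI impI)
  fix nt :: "('f, 'd) loop \<times> ('f, 'd) form \<rightharpoonup> ('f, 'd) form"
  assume nt: "\<forall>cond a \<phi> \<psi>. nt ((cond, a), \<phi>) = Some \<psi> \<longrightarrow>
    (\<exists>Cs es. eventual_increase I (cond, a) \<phi> Cs es \<and> \<psi> = eventual_increase_form a es)"
  show "conditional_nonterm_technique I nt"
    unfolding conditional_nonterm_technique_def
  proof (intro allI impI)
    fix cond a \<phi> \<psi> x
    assume "nt ((cond, a), \<phi>) = Some \<psi>" and wit: "nonterm_witness I (\<phi>, a) x"
      and \<psi>: "holds I \<psi> x"
    with nt obtain Cs es where ei: "eventual_increase I (cond, a) \<phi> Cs es"
      and \<psi>_eq: "\<psi> = eventual_increase_form a es"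
      by blast
    \<comment> \<open>The formula ranges over \<open>set es\<close>, the lemma over clause indices;
      equal lengths put each \<open>es ! i\<close> in \<open>set es\<close>.\<close>
    have "length es = length Cs"
      using ei by (simp add: eventual_increase_def)
    with \<psi> show "nonterm_witness I (cond, a) x"
      unfolding \<psi>_eq holds_eventual_increase_form
      by (intro eventual_increase_nonterm_witness[OF ei wit]) simp
  qed
next
  fix cond :: "('f, 'd) form" and a \<phi> Cs es x
  assume "eventual_increase I (cond, a) \<phi> Cs es" "nonterm_witness I (\<phi>, a) x"
    "\<forall>i < length Cs. 0 < aval I (es ! i) x \<and> aval I (es ! i) x \<le> aval I (es ! i) (step I a x)"
  then show "nonterm_witness I (cond, a) x"
    by (blast intro: eventual_increase_nonterm_witness)
qed

end
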